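(* Let $G$ be a graph. If $v\in V(G)$ then $v$ is a coloop of $$M_A(G(v,\ell i))=M_A(G-v)\oplus U_{1,1}(\{v\})=(M_A(G^{v}(v,\ell))/v)\oplus U_{1,1}(\{v\}).$$ Consequently $M_A(G(v,\ell i))$, $M_A(G-v)$, $M_A(G^{v}(v,\ell))/v$ and $M_A(G^{v}(v,\ell))$ all have the same nullity.
   Context: Graphs are finite and may have loops and parallel edges. $\mathcal{A}(G)$ is the symmetric $V(G)\times V(G)$ matrix over $GF(2)$ with $a_{vv}=1$ iff $v$ is looped and, for $v\ne w$, $a_{vw}=1$ iff $v,w$ are adjacent. The adjacency matroid $M_A(G)$ is the binary matroid on $V(G)$ whose circuits are the minimal nonempty $S\subseteq V(G)$ such that the columns of $\mathcal{A}(G)$ indexed by $S$ are linearly dependent over $GF(2)$. The local complement $G^{v}$ is the looped simple graph (no parallel edges, at most one loop per vertex) obtained from $G$ by toggling the loop status of every neighbor $w\neq v$ of $v$ and toggling the adjacency status of every pair of distinct neighbors of $v$ (both different from $v$); all other adjacencies and loop statuses, including the loop status of $v$, are unchanged, and parallel edges are replaced by single edges. For any graph $H$ with vertex $v$: $H(v)$ is obtained from $H$ by removing every loop at $v$; $H(v,\ell)$ is obtained from $H(v)$ by attaching a loop at $v$; $H(v,\ell i)$ is obtained from $H(v,\ell)$ by isolating $v$ (removing all non-loop edges incident on $v$). So $G^{v}(v,\ell)$ means $(G^v)(v,\ell)$. $G-v$ is the full subgraph induced by $V(G)\setminus\{v\}$. For a matroid $M$ on $V$ and $v\in V$: $v$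 is a coloop of $M$ if it belongs to no circuit; the contraction $M/v$ is the matroid on $V\setminus\{v\}$ whose circuits are the minimal nonempty $\gamma\subseteq V\setminus\{v\}$ such that $\gamma\cup\{v\}$ contains a circuit of $M$. $\oplus$ is the direct sum of matroids on disjoint ground sets, and $U_{1,1}(\{v\})$ is the matroid on $\{v\}$ in which $v$ is a coloop. The nullity of a matroid is the size of its ground set minus its rank. *)

theory Defs
  imports "HOL-Library.Multiset" "HOL-Library.Uprod" "HOL-Library.Z2"
begin

section \<open>Graphs with loops and parallel edges\<close>

text \<open>An edge is the unordered pair of its ends (a loop at \<open>v\<close> is \<open>Upair v v\<close>); parallel edges
  are recorded by multiplicity.\<close>

record 'v graph =
  verts :: "'v set"
  edges :: "'v uprod multiset"

locale finite_graph =
  fixes G :: "'v graph"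
  assumes finite_verts: "finite (verts G)"
    and edges_wf: "e \<in># edges G \<Longrightarrow> set_uprod e \<subseteq> verts G"

definition looped :: "'v graph \<Rightarrow> 'v \<Rightarrow> bool" where
  "looped G v \<longleftrightarrow> Upair v v \<in># edges G"

definition adjacent :: "'v graph \<Rightarrow> 'v \<Rightarrow> 'v \<Rightarrow> bool" where
  "adjacent G v w \<longleftrightarrow> v \<noteq> w \<and> Upair v w \<in># edges G"

text \<open>In this order: \<open>H(v)\<close>, \<open>H(v,\<ell>)\<close>, \<open>H(v,\<ell>i)\<close>, \<open>H - v\<close>.\<close>

definition unlooped_at :: "'v graph \<Rightarrow> 'v \<Rightarrow> 'v graph" where
  "unlooped_at H v = H\<lparr>edges := filter_mset (\<lambda>e. e \<noteq> Upair v v) (edges H)\<rparr>"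

definition looped_at :: "'v graph \<Rightarrow> 'v \<Rightarrow> 'v graph" where
  "looped_at H v = (unlooped_at H v)\<lparr>edges := add_mset (Upair v v) (edges (unlooped_at H v))\<rparr>"

definition looped_isolated_at :: "'v graph \<Rightarrow> 'v \<Rightarrow> 'v graph" where
  "looped_isolated_at H v = (looped_at H v)
     \<lparr>edges := filter_mset (\<lambda>e. v \<in> set_uprod e \<longrightarrow> e = Upair v v) (edges (looped_at H v))\<rparr>"

definition delete_vertex :: "'v graph \<Rightarrow> 'v \<Rightarrow> 'v graph" where
  "delete_vertex H v =
     \<lparr>verts = verts H - {v}, edges = filter_mset (\<lambda>e. v \<notin> set_uprod e) (edges H)\<rparr>"

text \<open>The local complement \<open>G\<^sup>v\<close>. The toggled pairs \<open>Upair x y\<close> include the case \<open>x = y\<close>, that is,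
  the loops at the neighbours of \<open>v\<close>; since \<open>adjacent\<close> is irreflexive, nothing at \<open>v\<close> is toggled.
  Passing to a set and back with \<^const>\<open>mset_set\<close> merges parallel edges.\<close>

definition local_complement :: "'v graph \<Rightarrow> 'v \<Rightarrow> 'v graph" where
  "local_complement G v = G\<lparr>edges := mset_set (sym_diff (set_mset (edges G))
     {Upair x y | x y. adjacent G v x \<and> adjacent G v y})\<rparr>"

definition adjacency_matrix :: "'v graph \<Rightarrow> 'v \<Rightarrow> 'v \<Rightarrow> bit" where
  "adjacency_matrix G v w = of_bool (if v = w then looped G v else adjacent G v w)"


section \<open>Matroids given by their circuits\<close>

record 'a matroid =
  ground :: "'a set"
  circuits :: "'a set set"

locale finite_matroid =
  fixes M :: "'a matroid"
  assumes finite_ground: "finite (ground M)"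
    and circuit_subset: "C \<in> circuits M \<Longrightarrow> C \<subseteq> ground M"
    and circuit_nonempty: "C \<in> circuits M \<Longrightarrow> C \<noteq> {}"
    and circuit_antichain: "C \<in> circuits M \<Longrightarrow> D \<in> circuits M \<Longrightarrow> C \<subseteq> D \<Longrightarrow> C = D"
    and circuit_elimination: "C \<in> circuits M \<Longrightarrow> D \<in> circuits M \<Longrightarrow> C \<noteq> D \<Longrightarrow> e \<in> C \<inter> D
      \<Longrightarrow> \<exists>B\<in>circuits M. B \<subseteq> C \<union> D - {e}"

definition coloop :: "'a matroid \<Rightarrow> 'a \<Rightarrow> bool" where
  "coloop M v \<longleftrightarrow> v \<in> ground M \<and> (\<forall>C\<in>circuits M. v \<notin> C)"

definition indep :: "'a matroid \<Rightarrow> 'a set \<Rightarrow> bool" where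
  "indep M I \<longleftrightarrow> I \<subseteq> ground M \<and> (\<forall>C\<in>circuits M. \<not> C \<subseteq> I)"

definition rank :: "'a matroid \<Rightarrow> nat" where
  "rank M = Max (card ` {I. indep M I})"

definition nullity :: "'a matroid \<Rightarrow> nat" where
  "nullity M = card (ground M) - rank M"

definition minimal_sets :: "('a set \<Rightarrow> bool) \<Rightarrow> 'a set set" where
  "minimal_sets P = {S. P S \<and> (\<forall>T. P T \<longrightarrow> T \<subseteq> S \<longrightarrow> T = S)}"

text \<open>If \<open>{v}\<close> is not a circuit, these are the minimal nonempty sets among the \<open>C - {v}\<close> for circuits
  \<open>C\<close>, as in the usual description of the contraction (see \<open>circuits_contract\<close> below). If \<open>{v}\<close> is a
  circuit, then every singleton becomes a circuit, which differs from the usual convention; this does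
  not happen for \<open>M\<^sub>A(G\<^sup>v(v,\<ell>))\<close> (see \<open>singleton_not_circuit_looped_at\<close> below).\<close>

definition contract :: "'a matroid \<Rightarrow> 'a \<Rightarrow> 'a matroid" where
  "contract M v = \<lparr>ground = ground M - {v},
     circuits = minimal_sets (\<lambda>S. S \<noteq> {} \<and> S \<subseteq> ground M - {v} \<and> (\<exists>C\<in>circuits M. C \<subseteq> S \<union> {v}))\<rparr>"

text \<open>Meaningful for disjoint ground sets.\<close>

definition direct_sum :: "'a matroid \<Rightarrow> 'a matroid \<Rightarrow> 'a matroid"  (infixl "\<oplus>" 65) where
  "M \<oplus> N = \<lparr>ground = ground M \<union> ground N, circuits = circuits M \<union> circuits N\<rparr>"

definition U\<^sub>1\<^sub>1 :: "'a \<Rightarrow> 'a matroid" where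
  "U\<^sub>1\<^sub>1 v = \<lparr>ground = {v}, circuits = {}\<rparr>"

text \<open>Dependence of the family of columns indexed by \<open>S\<close>; distinct indices with equal columns are
  dependent, so this is not dependence of the set of columns.\<close>

definition columns_dependent :: "'a set \<Rightarrow> ('a \<Rightarrow> 'b \<Rightarrow> bit) \<Rightarrow> 'b set \<Rightarrow> bool" where
  "columns_dependent R A S \<longleftrightarrow>
     (\<exists>c. (\<exists>s\<in>S. c s \<noteq> 0) \<and> (\<forall>r\<in>R. (\<Sum>s\<in>S. c s * A r s) = 0))"

definition adjacency_matroid :: "'v graph \<Rightarrow> 'v matroid"  ("M\<^sub>A") where
  "M\<^sub>A G = \<lparr>ground = verts G, circuits = minimal_sets
     (\<lambda>S. S \<noteq> {} \<and> S \<subseteq> verts G \<and> columns_dependent (verts G) (adjacency_matrix G) S)\<rparr>"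


section \<open>Well-formedness\<close>

lemma finite_graph_unlooped_at: "finite_graph H \<Longrightarrow> finite_graph (unlooped_at H v)"
  by (auto simp: finite_graph_def unlooped_at_def)

lemma finite_graph_looped_at: "finite_graph H \<Longrightarrow> v \<in> verts H \<Longrightarrow> finite_graph (looped_at H v)"
  by (auto simp: finite_graph_def looped_at_def unlooped_at_def)

lemma finite_graph_looped_isolated_at:
  "finite_graph H \<Longrightarrow> v \<in> verts H \<Longrightarrow> finite_graph (looped_isolated_at H v)"
  by (auto simp: finite_graph_def looped_isolated_at_def looped_at_def unlooped_at_def)

lemma finite_graph_delete_vertex: "finite_graph H \<Longrightarrow> finite_graph (delete_vertex H v)"
  by (auto simp: finite_graph_def delete_vertex_def)

lemma adjacent_in_verts: "finite_graph G \<Longrightarrow> adjacent G v w \<Longrightarrow> v \<in> verts G \<and> w \<in> verts G"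
  unfolding adjacent_def finite_graph_def by fastforce

lemma finite_toggled:
  assumes "finite_graph G"
  shows "finite {Upair x y | x y. adjacent G v x \<and> adjacent G v y}"
proof (rule finite_subset)
  show "{Upair x y | x y. adjacent G v x \<and> adjacent G v y}
    \<subseteq> (\<lambda>(x, y). Upair x y) ` (verts G \<times> verts G)"
    using adjacent_in_verts[OF assms] by fastforce
  show "finite ((\<lambda>(x, y). Upair x y) ` (verts G \<times> verts G))"
    using assms by (simp add: finite_graph_def)
qed

lemma set_edges_local_complement:
  assumes "finite_graph G"
  shows "Upair x y \<in># edges (local_complement G v) \<longleftrightarrow>
    (Upair x y \<in># edges G) \<noteq> (adjacent G v x \<and> adjacent G v y)"
  using finite_toggled[OF assms, of v] by (auto simp: local_complement_def)

lemma finite_graph_local_complement: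
  assumes "finite_graph G"
  shows "finite_graph (local_complement G v)"
proof
  show "finite (verts (local_complement G v))"
    using assms by (simp add: local_complement_def finite_graph_def)
  fix e assume e: "e \<in># edges (local_complement G v)"
  obtain x y where "e = Upair x y" by (cases e)
  then show "set_uprod e \<subseteq> verts (local_complement G v)"
    using e set_edges_local_complement[OF assms] adjacent_in_verts[OF assms]
      finite_graph.edges_wf[OF assms, of e]
    by (auto simp: local_complement_def)
qed

lemma looped_local_complement:
  "finite_graph G \<Longrightarrow> looped (local_complement G v) x \<longleftrightarrow> looped G x \<noteq> adjacent G v x"
  by (simp add: looped_def set_edges_local_complement)

lemma adjacent_local_complement:
  "finite_graph G \<Longrightarrow> adjacent (local_complement G v) x y \<longleftrightarrow>
    x \<noteq> y \<and> adjacent G x y \<noteq> (adjacent G v x \<and> adjacent G v y)"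
  by (auto simp: adjacent_def set_edges_local_complement)

lemma minimal_sets_below:
  assumes "finite S" "P S"
  shows "\<exists>T\<in>minimal_sets P. T \<subseteq> S"
  using assms
proof (induction S rule: finite_psubset_induct)
  case (psubset S)
  show ?case
  proof (cases "S \<in> minimal_sets P")
    case False
    then obtain T where "P T" "T \<subset> S" using psubset.prems by (auto simp: minimal_sets_def)
    then obtain U where "U \<in> minimal_sets P" "U \<subseteq> T" using psubset.IH[of T] by auto
    then show ?thesis using \<open>T \<subset> S\<close> by (intro bexI[of _ U]) auto
  qed auto
qed

lemma minimal_sets_eqI:
  assumes QP: "\<And>S. Q S \<Longrightarrow> P S" and PQ: "\<And>S. P S \<Longrightarrow> \<exists>T. Q T \<and> T \<subseteq> S"
  shows "minimal_sets P = minimal_sets Q"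
proof (intro set_eqI iffI)
  fix S assume S: "S \<in> minimal_sets P"
  then obtain T where T: "Q T" "T \<subseteq> S" using PQ[of S] by (auto simp: minimal_sets_def)
  then have "T = S" using S QP unfolding minimal_sets_def by blast
  then show "S \<in> minimal_sets Q" using S T(1) QP unfolding minimal_sets_def by blast
next
  fix S assume S: "S \<in> minimal_sets Q"
  have "T = S" if T: "P T" "T \<subseteq> S" for T
  proof -
    obtain U where "Q U" "U \<subseteq> T" using PQ[OF T(1)] by blast
    then show ?thesis using S T unfolding minimal_sets_def by blast
  qed
  then show "S \<in> minimal_sets P" using S QP unfolding minimal_sets_def by blast
qed

lemma bit_add_eq_0_trans: "(x :: bit) + y = 0 \<Longrightarrow> z + y = 0 \<Longrightarrow> x + z = 0"
  by (cases x; cases y; cases z) simp_all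

lemma binary_circuit_sum:
  assumes "finite E" and
    C: "C \<in> minimal_sets (\<lambda>S. S \<noteq> {} \<and> S \<subseteq> E \<and> columns_dependent R A S)" and "r \<in> R"
  shows "(\<Sum>s\<in>C. A r s) = 0"
proof -
  have CE: "C \<subseteq> E" using C by (simp add: minimal_sets_def)
  have fin: "finite C" using CE assms(1) by (rule finite_subset)
  have "columns_dependent R A C" using C by (simp add: minimal_sets_def)
  then obtain c where c: "\<exists>s\<in>C. c s \<noteq> 0" "\<forall>r\<in>R. (\<Sum>s\<in>C. c s * A r s) = 0"
    unfolding columns_dependent_def by blast
  define T where "T = {s\<in>C. c s \<noteq> 0}"
  have "(\<Sum>s\<in>T. c s * A r s) = (\<Sum>s\<in>C. c s * A r s)" for r
    using fin by (intro sum.mono_neutral_left) (auto simp: T_def)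
  moreover have ne: "\<exists>s\<in>T. c s \<noteq> 0" using c(1) by (auto simp: T_def)
  ultimately have "columns_dependent R A T" using c(2) unfolding columns_dependent_def
    by (intro exI[of _ c]) (simp del: mult_bit_eq_and bit_not_zero_iff)
  moreover have "T \<noteq> {}" using ne by auto
  moreover have "T \<subseteq> C" by (auto simp: T_def)
  ultimately have "T = C" using C CE by (simp add: minimal_sets_def)
  then have "c s = 1" if "s \<in> C" for s using that by (auto simp: T_def)
  then have "(\<Sum>s\<in>C. A r s) = (\<Sum>s\<in>C. c s * A r s)"
    by (intro sum.cong) (simp_all del: mult_bit_eq_and)
  then show ?thesis using c(2) assms(3) by simp
qed

lemma finite_matroid_adjacency_matroid:
  assumes "finite_graph G"
  shows "finite_matroid (M\<^sub>A G)"
proof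
  let ?P = "\<lambda>S. S \<noteq> {} \<and> S \<subseteq> verts G \<and> columns_dependent (verts G) (adjacency_matrix G) S"
  have fin: "finite (verts G)" using assms by (simp add: finite_graph_def)
  show "finite (ground (M\<^sub>A G))" using fin by (simp add: adjacency_matroid_def)
  show "C \<subseteq> ground (M\<^sub>A G)" if "C \<in> circuits (M\<^sub>A G)" for C
    using that by (simp add: adjacency_matroid_def minimal_sets_def)
  show "C \<noteq> {}" if "C \<in> circuits (M\<^sub>A G)" for C
    using that by (simp add: adjacency_matroid_def minimal_sets_def)
  show "C = D" if "C \<in> circuits (M\<^sub>A G)" "D \<in> circuits (M\<^sub>A G)" "C \<subseteq> D" for C D
    using that by (simp add: adjacency_matroid_def minimal_sets_def)
  show "\<exists>B\<in>circuits (M\<^sub>A G). B \<subseteq> C \<union> D - {e}"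
    if "C \<in> circuits (M\<^sub>A G)" "D \<in> circuits (M\<^sub>A G)" "C \<noteq> D" "e \<in> C \<inter> D" for C D e
  proof -
    have CD: "C \<in> minimal_sets ?P" "D \<in> minimal_sets ?P"
      using that by (simp_all add: adjacency_matroid_def)
    have sub: "C \<subseteq> verts G" "D \<subseteq> verts G" using CD by (auto simp: minimal_sets_def)
    have fCD: "finite C" "finite D" using sub fin by (auto intro: finite_subset)
    have "(\<Sum>s\<in>sym_diff C D. adjacency_matrix G r s) = 0" if "r \<in> verts G" for r
    proof -
      let ?f = "adjacency_matrix G r"
      have "sum ?f C = sum ?f (C - D) + sum ?f (C \<inter> D)"
        using fCD sum.Int_Diff[of C ?f D] by (simp add: add.commute del: add_bit_eq_xor)
      moreover have "sum ?f D = sum ?f (D - C) + sum ?f (C \<inter> D)"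
        using fCD sum.Int_Diff[of D ?f C] by (simp add: add.commute Int_commute del: add_bit_eq_xor)
      moreover have "sum ?f (sym_diff C D) = sum ?f (C - D) + sum ?f (D - C)"
        using fCD by (intro sum.union_disjoint) auto
      ultimately show ?thesis
        using binary_circuit_sum[OF fin CD(1) that] binary_circuit_sum[OF fin CD(2) that]
          bit_add_eq_0_trans[of "sum ?f (C - D)" "sum ?f (C \<inter> D)" "sum ?f (D - C)"]
        by (simp del: add_bit_eq_xor)
    qed
    then have "columns_dependent (verts G) (adjacency_matrix G) (sym_diff C D)"
      unfolding columns_dependent_def using \<open>C \<noteq> D\<close>
      by (intro exI[of _ "\<lambda>_. 1"]) (auto simp del: mult_bit_eq_and)
    then have "?P (sym_diff C D)" using sub \<open>C \<noteq> D\<close> by auto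
    moreover have "finite (sym_diff C D)" using fCD by simp
    ultimately obtain B where "B \<in> minimal_sets ?P" "B \<subseteq> sym_diff C D"
      using minimal_sets_below[of "sym_diff C D" ?P] by blast
    then show ?thesis using that(4) by (auto simp: adjacency_matroid_def)
  qed
qed

lemma finite_matroid_U\<^sub>1\<^sub>1: "finite_matroid (U\<^sub>1\<^sub>1 v)"
  by (simp add: finite_matroid_def U\<^sub>1\<^sub>1_def)

lemma coloop_U\<^sub>1\<^sub>1: "coloop (U\<^sub>1\<^sub>1 v) v"
  by (simp add: coloop_def U\<^sub>1\<^sub>1_def)

lemma finite_matroid_direct_sum:
  assumes "finite_matroid M" "finite_matroid N" "ground M \<inter> ground N = {}"
  shows "finite_matroid (M \<oplus> N)"
proof -
  interpret M: finite_matroid M by fact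
  interpret N: finite_matroid N by fact
  have disj: "C \<inter> D = {}" if "C \<in> circuits M" "D \<in> circuits N" for C D
    using that M.circuit_subset N.circuit_subset assms(3) by blast
  show ?thesis
  proof
    show "finite (ground (M \<oplus> N))"
      using M.finite_ground N.finite_ground by (simp add: direct_sum_def)
    show "C \<subseteq> ground (M \<oplus> N)" if "C \<in> circuits (M \<oplus> N)" for C
      using that M.circuit_subset N.circuit_subset by (auto simp: direct_sum_def)
    show "C \<noteq> {}" if "C \<in> circuits (M \<oplus> N)" for C
      using that M.circuit_nonempty N.circuit_nonempty by (auto simp: direct_sum_def)
    show "C = D" if "C \<in> circuits (M \<oplus> N)" "D \<in> circuits (M \<oplus> N)" "C \<subseteq> D" for C D
      using that M.circuit_antichain[of C D] N.circuit_antichain[of C D] disj[of C D] disj[of D C]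
        M.circuit_nonempty[of C] N.circuit_nonempty[of C]
      by (auto simp: direct_sum_def)
    show "\<exists>B\<in>circuits (M \<oplus> N). B \<subseteq> C \<union> D - {e}"
      if "C \<in> circuits (M \<oplus> N)" "D \<in> circuits (M \<oplus> N)" "C \<noteq> D" "e \<in> C \<inter> D" for C D e
      using that M.circuit_elimination[of C D e] N.circuit_elimination[of C D e]
        disj[of C D] disj[of D C]
      by (auto simp: direct_sum_def)
  qed
qed

context finite_matroid
begin

lemma circuits_contract:
  assumes "{v} \<notin> circuits M"
  shows "circuits (contract M v) = minimal_sets (\<lambda>S. S \<noteq> {} \<and> (\<exists>C\<in>circuits M. S = C - {v}))"
    (is "?L = minimal_sets ?Q")
proof -
  let ?P = "\<lambda>S. S \<noteq> {} \<and> S \<subseteq> ground M - {v} \<and> (\<exists>C\<in>circuits M. C \<subseteq> S \<union> {v})"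
  have ne: "C - {v} \<noteq> {}" if "C \<in> circuits M" for C
    using that assms circuit_nonempty[of C] by (auto simp: subset_singleton_iff)
  have QP: "?P S" if "?Q S" for S using that circuit_subset by blast
  have PQ: "\<exists>T. ?Q T \<and> T \<subseteq> S" if S: "?P S" for S
  proof -
    obtain C where "C \<in> circuits M" "C \<subseteq> S \<union> {v}" using S by auto
    then show ?thesis using ne[of C] by (intro exI[of _ "C - {v}"]) auto
  qed
  have "minimal_sets ?P = minimal_sets ?Q" using QP PQ by (rule minimal_sets_eqI)
  then show ?thesis by (simp add: contract_def)
qed

lemma finite_matroid_contract: "finite_matroid (contract M v)"
proof
  let ?P = "\<lambda>S. S \<noteq> {} \<and> S \<subseteq> ground M - {v} \<and> (\<exists>C\<in>circuits M. C \<subseteq> S \<union> {v})"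
  have circ: "circuits (contract M v) = minimal_sets ?P" by (simp add: contract_def)
  show "finite (ground (contract M v))" using finite_ground by (simp add: contract_def)
  show "C \<subseteq> ground (contract M v)" if "C \<in> circuits (contract M v)" for C
    using that by (simp add: contract_def minimal_sets_def)
  show "C \<noteq> {}" if "C \<in> circuits (contract M v)" for C
    using that by (simp add: contract_def minimal_sets_def)
  show "C = D" if "C \<in> circuits (contract M v)" "D \<in> circuits (contract M v)" "C \<subseteq> D" for C D
    using that by (simp add: contract_def minimal_sets_def)
  show "\<exists>B\<in>circuits (contract M v). B \<subseteq> C \<union> D - {e}"
    if CD: "C \<in> circuits (contract M v)" "D \<in> circuits (contract M v)" "C \<noteq> D" "e \<in> C \<inter> D" for C D e
  proof -
    have PC: "?P C" and PD: "?P D" using CD by (auto simp: circ minimal_sets_def)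
    have "?P (C \<union> D - {e})"
    proof (intro conjI)
      show "C \<union> D - {e} \<noteq> {}" using CD(3,4) by blast
      show "C \<union> D - {e} \<subseteq> ground M - {v}" using PC PD by blast
      show "\<exists>B\<in>circuits M. B \<subseteq> (C \<union> D - {e}) \<union> {v}"
      proof (cases "{v} \<in> circuits M")
        case True
        then show ?thesis by blast
      next
        case False
        then obtain C' D' where C': "C' \<in> circuits M" "C = C' - {v}"
          and D': "D' \<in> circuits M" "D = D' - {v}"
          using CD(1,2) circuits_contract[OF False] unfolding minimal_sets_def by auto
        then show ?thesis using circuit_elimination[of C' D' e] CD(3,4) by blast
      qed
    qed
    moreover have "finite (C \<union> D - {e})"
      using PC PD finite_ground by (auto intro: finite_subset)
    ultimately show ?thesis using minimal_sets_below[of "C \<union> D - {e}" ?P] by (simp add: circ)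
  qed
qed

lemma finite_indep: "finite {I. indep M I}"
  using finite_ground by (auto simp: indep_def intro: finite_subset[of _ "Pow (ground M)"])

lemma rank_le_card_ground: "rank M \<le> card (ground M)"
proof -
  have "indep M {}" using circuit_nonempty by (auto simp: indep_def)
  then have "card ` {I. indep M I} \<noteq> {}" by auto
  moreover have "k \<le> card (ground M)" if "k \<in> card ` {I. indep M I}" for k
    using that finite_ground by (auto simp: indep_def intro: card_mono)
  ultimately show ?thesis unfolding rank_def
    using finite_indep by (intro Max.boundedI) simp_all
qed

end

lemma singleton_not_circuit_looped_at:
  assumes "v \<in> verts H"
  shows "{v} \<notin> circuits (M\<^sub>A (looped_at H v))"
proof
  have vH: "v \<in> verts (looped_at H v)"
    using assms by (simp add: looped_at_def unlooped_at_def)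
  assume "{v} \<in> circuits (M\<^sub>A (looped_at H v))"
  then have "columns_dependent (verts (looped_at H v)) (adjacency_matrix (looped_at H v)) {v}"
    by (simp add: adjacency_matroid_def minimal_sets_def)
  then have "adjacency_matrix (looped_at H v) v v = 0"
    using vH by (auto simp: columns_dependent_def simp del: mult_bit_eq_and bit_not_zero_iff)
  then show False by (simp add: adjacency_matrix_def looped_def looped_at_def)
qed

end

theory Submission
  imports Defs
begin

text \<open>
  Over \<open>GF(2)\<close> a linear relation between columns is just a set of columns with sum zero, so
  \<open>M\<^sub>A(H)\<close> is determined by the nonempty zero-sum sets of vertices of \<open>H\<close>, its circuits being the
  minimal ones. All three matroids are compared through these sets.

  In \<open>G(v,\<ell>i)\<close> the row of \<open>v\<close> is the unit vector at \<open>v\<close>. It forbids \<open>v\<close> in a zero-sum set, and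
  the remaining rows are those of \<open>G - v\<close>; this gives \<open>M\<^sub>A(G(v,\<ell>i)) = M\<^sub>A(G - v) \<oplus> U\<^sub>1\<^sub>1(v)\<close>
  (\<open>adjacency_matroid_looped_isolated_at\<close>).

  In \<open>G\<^sup>v(v,\<ell>)\<close> the matrix is, outside the row and the column of \<open>v\<close>, the matrix of \<open>G\<close> plus the
  outer product of the neighbourhood vector of \<open>v\<close> with itself. Hence pivoting on the diagonal entry
  \<open>1\<close> at \<open>v\<close> (adding row \<open>v\<close> to the rows of the neighbours of \<open>v\<close>) clears the column of \<open>v\<close> and
  undoes the local complementation, leaving the matrix of \<open>G - v\<close>
  (\<open>row_sum_looped_local_complement\<close>). So each zero-sum set \<open>S\<close> of
  \<open>G - v\<close> becomes a zero-sum set of \<open>G\<^sup>v(v,\<ell>)\<close> in exactly one way, namely as \<open>S\<close> or \<open>S \<union> {v}\<close>,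
  whichever satisfies row \<open>v\<close>; conversely every zero-sum set arises so. Deleting \<open>v\<close> from the
  zero-sum sets is contraction, so \<open>M\<^sub>A(G - v) = M\<^sub>A(G\<^sup>v(v,\<ell>))/v\<close>.

  The nullities agree because contracting an element that is not a loop of the matroid lowers both
  rank and size by one (\<open>nullity_contract\<close>), and \<open>M\<close> is the contraction of \<open>M \<oplus> U\<^sub>1\<^sub>1(v)\<close> by \<open>v\<close>
  for every \<open>M\<close> whose ground set omits \<open>v\<close> (\<open>contract_direct_sum_U\<^sub>1\<^sub>1\<close>).
\<close>

section \<open>Rank and nullity of a contraction\<close>

context finite_matroid
begin

lemma indep_empty: "indep M {}"
  using circuit_nonempty by (auto simp: indep_def)

lemma card_le_rank: "indep M I \<Longrightarrow> card I \<le> rank M"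
  unfolding rank_def using finite_indep by (intro Max_ge) auto

lemma obtain_basis:
  obtains I where "indep M I" "card I = rank M"
proof -
  have "rank M \<in> card ` {I. indep M I}"
    unfolding rank_def using finite_indep indep_empty by (intro Max_in) auto
  then show ?thesis using that by auto
qed

lemma indep_finite: "indep M I \<Longrightarrow> finite I"
  using finite_ground by (auto simp: indep_def intro: finite_subset)

text \<open>A basis \<open>I\<close> avoiding \<open>v\<close> can be exchanged: \<open>I \<union> {v}\<close> contains a circuit through \<open>v\<close>, and by
  circuit elimination only one, so that removing another element of that circuit restores
  independence without changing the size.\<close>

lemma obtain_basis_containing:
  assumes v: "v \<in> ground M" "{v} \<notin> circuits M"
  obtains I where "indep M I" "card I = rank M" "v \<in> I"
proof -
  obtain I where I: "indep M I" "card I = rank M" by (rule obtain_basis)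
  show ?thesis
  proof (cases "v \<in> I")
    case True
    with I that show ?thesis by blast
  next
    case False
    have fin: "finite I" using I(1) by (rule indep_finite)
    have "\<not> indep M (insert v I)"
      using card_le_rank[of "insert v I"] I(2) False fin by auto
    then obtain C where C: "C \<in> circuits M" "C \<subseteq> insert v I"
      using I(1) v(1) by (auto simp: indep_def)
    have vC: "v \<in> C" using C I(1) by (auto simp: indep_def)
    have "C \<noteq> {v}" using C(1) v(2) by auto
    then obtain e where e: "e \<in> C" "e \<noteq> v" using vC by auto
    have "indep M (insert v I - {e})"
      unfolding indep_def
    proof (intro conjI ballI notI)
      show "insert v I - {e} \<subseteq> ground M" using I(1) v(1) by (auto simp: indep_def)
    next
      fix D assume D: "D \<in> circuits M" "D \<subseteq> insert v I - {e}"
      have "v \<in> D" using D I(1) by (auto simp: indep_def)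
      then obtain B where "B \<in> circuits M" "B \<subseteq> C \<union> D - {v}"
        using circuit_elimination[OF C(1) D(1), of v] vC e D(2) by blast
      then show False using C(2) D(2) I(1) unfolding indep_def by blast
    qed
    moreover have "card (insert v I - {e}) = rank M"
      using e C(2) False fin I(2) by auto
    ultimately show ?thesis using e that by blast
  qed
qed

text \<open>Since \<open>{v}\<close> is not a circuit, a circuit inside \<open>I \<union> {v}\<close> leaves a nonempty part in \<open>I\<close>; this
  is where the hypothesis enters, as \<open>{}\<close> is independent in every contraction.\<close>

lemma indep_contract_iff:
  assumes v: "v \<in> ground M" "{v} \<notin> circuits M"
  shows "indep (contract M v) I \<longleftrightarrow> v \<notin> I \<and> indep M (insert v I)"
proof -
  let ?P = "\<lambda>S. S \<noteq> {} \<and> S \<subseteq> ground M - {v} \<and> (\<exists>C\<in>circuits M. C \<subseteq> S \<union> {v})"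
  have "(\<exists>S\<in>circuits (contract M v). S \<subseteq> I) \<longleftrightarrow> (\<exists>C\<in>circuits M. C \<subseteq> insert v I)"
    if I: "I \<subseteq> ground M - {v}"
  proof
    assume "\<exists>S\<in>circuits (contract M v). S \<subseteq> I"
    then obtain S where S: "S \<in> circuits (contract M v)" "S \<subseteq> I" by blast
    have "\<exists>C\<in>circuits M. C \<subseteq> S \<union> {v}" using S(1) by (simp add: contract_def minimal_sets_def)
    then show "\<exists>C\<in>circuits M. C \<subseteq> insert v I" using S(2) by blast
  next
    assume C: "\<exists>C\<in>circuits M. C \<subseteq> insert v I"
    have "I \<noteq> {}" using C circuit_nonempty v(2) by (auto simp: subset_singleton_iff)
    then have "?P I" using C I by simp
    moreover have "finite I" using I finite_ground by (auto intro: finite_subset)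
    ultimately have "\<exists>S\<in>minimal_sets ?P. S \<subseteq> I" by (intro minimal_sets_below)
    then show "\<exists>S\<in>circuits (contract M v). S \<subseteq> I" by (simp add: contract_def)
  qed
  moreover have "indep (contract M v) I \<longleftrightarrow>
      I \<subseteq> ground M - {v} \<and> \<not> (\<exists>S\<in>circuits (contract M v). S \<subseteq> I)"
    by (simp add: indep_def contract_def)
  moreover have "v \<notin> I \<and> indep M (insert v I) \<longleftrightarrow>
      I \<subseteq> ground M - {v} \<and> \<not> (\<exists>C\<in>circuits M. C \<subseteq> insert v I)"
    using v(1) unfolding indep_def by blast
  ultimately show ?thesis by metis
qed

lemma rank_contract:
  assumes "v \<in> ground M" "{v} \<notin> circuits M"
  shows "rank M = Suc (rank (contract M v))"
proof (rule antisym)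
  interpret C: finite_matroid "contract M v" by (rule finite_matroid_contract)
  note iff = indep_contract_iff[OF assms]
  obtain I where I: "indep M I" "card I = rank M" "v \<in> I"
    by (rule obtain_basis_containing[OF assms])
  then have "indep (contract M v) (I - {v})" by (simp add: iff insert_absorb)
  then have "card (I - {v}) \<le> rank (contract M v)" by (rule C.card_le_rank)
  then show "rank M \<le> Suc (rank (contract M v))" using I by simp
  obtain J where J: "indep (contract M v) J" "card J = rank (contract M v)"
    by (rule C.obtain_basis)
  then show "Suc (rank (contract M v)) \<le> rank M"
    using card_le_rank[of "insert v J"] C.indep_finite[of J] by (simp add: iff)
qed

lemma nullity_contract:
  assumes "v \<in> ground M" "{v} \<notin> circuits M"
  shows "nullity (contract M v) = nullity M"
proof -
  have "ground (contract M v) = ground M - {v}" by (simp add: contract_def)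
  then show ?thesis
    using rank_contract[OF assms] assms(1) finite_ground by (simp add: nullity_def)
qed

text \<open>Reading a matroid as a contraction of its extension by a coloop reduces the nullity of that
  extension to \<open>nullity_contract\<close>.\<close>

lemma contract_direct_sum_U\<^sub>1\<^sub>1:
  assumes "v \<notin> ground M"
  shows "contract (M \<oplus> U\<^sub>1\<^sub>1 v) v = M"
proof -
  let ?P = "\<lambda>S. S \<noteq> {} \<and> S \<subseteq> ground M \<and> (\<exists>C\<in>circuits M. C \<subseteq> S \<union> {v})"
  have "minimal_sets ?P = minimal_sets (\<lambda>S. S \<in> circuits M)"
  proof (rule minimal_sets_eqI)
    show "?P S" if "S \<in> circuits M" for S
      using that circuit_nonempty circuit_subset by blast
    show "\<exists>T. T \<in> circuits M \<and> T \<subseteq> S" if "?P S" for S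
      using that circuit_subset assms by blast
  qed
  also have "\<dots> = circuits M" using circuit_antichain by (auto simp: minimal_sets_def)
  finally show ?thesis using assms by (simp add: contract_def direct_sum_def U\<^sub>1\<^sub>1_def)
qed

lemma nullity_direct_sum_U\<^sub>1\<^sub>1:
  assumes "v \<notin> ground M"
  shows "nullity (M \<oplus> U\<^sub>1\<^sub>1 v) = nullity M"
proof -
  interpret S: finite_matroid "M \<oplus> U\<^sub>1\<^sub>1 v"
    using assms finite_matroid_axioms finite_matroid_U\<^sub>1\<^sub>1
    by (intro finite_matroid_direct_sum) (auto simp: U\<^sub>1\<^sub>1_def)
  have "v \<in> ground (M \<oplus> U\<^sub>1\<^sub>1 v)" "{v} \<notin> circuits (M \<oplus> U\<^sub>1\<^sub>1 v)"
    using assms circuit_subset by (auto simp: direct_sum_def U\<^sub>1\<^sub>1_def)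
  then show ?thesis using S.nullity_contract contract_direct_sum_U\<^sub>1\<^sub>1[OF assms] by metis
qed

end

section \<open>Zero-sum sets of columns\<close>

definition row_sum :: "'v graph \<Rightarrow> 'v \<Rightarrow> 'v set \<Rightarrow> bit" where
  "row_sum G r S = (\<Sum>s\<in>S. adjacency_matrix G r s)"

definition zero_sum :: "'v graph \<Rightarrow> 'v set \<Rightarrow> bool" where
  "zero_sum G S \<longleftrightarrow> S \<noteq> {} \<and> S \<subseteq> verts G \<and> (\<forall>r\<in>verts G. row_sum G r S = 0)"

text \<open>The only nonzero coefficient in \<open>GF(2)\<close> is \<open>1\<close>, so the support of a linear relation is a
  zero-sum set.\<close>

lemma circuits_adjacency_matroid:
  assumes "finite_graph G"
  shows "circuits (M\<^sub>A G) = minimal_sets (zero_sum G)"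
proof -
  let ?A = "adjacency_matrix G"
  let ?P = "\<lambda>S. S \<noteq> {} \<and> S \<subseteq> verts G \<and> columns_dependent (verts G) ?A S"
  have "minimal_sets ?P = minimal_sets (zero_sum G)"
  proof (rule minimal_sets_eqI)
    fix S assume S: "zero_sum G S"
    then have "columns_dependent (verts G) ?A S"
      unfolding columns_dependent_def zero_sum_def row_sum_def
      by (intro exI[of _ "\<lambda>_. 1"]) (auto simp del: mult_bit_eq_and)
    then show "?P S" using S by (simp add: zero_sum_def)
  next
    fix S assume S: "?P S"
    then obtain c where c: "\<exists>s\<in>S. c s \<noteq> 0" "\<And>r. r \<in> verts G \<Longrightarrow> (\<Sum>s\<in>S. c s * ?A r s) = 0"
      unfolding columns_dependent_def by blast
    define T where "T = {s\<in>S. c s \<noteq> 0}"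
    have fin: "finite S" using S assms by (auto simp: finite_graph_def intro: finite_subset)
    have "row_sum G r T = 0" if "r \<in> verts G" for r
    proof -
      have "row_sum G r T = (\<Sum>s\<in>T. c s * ?A r s)"
        unfolding row_sum_def by (intro sum.cong) (auto simp: T_def simp del: mult_bit_eq_and)
      also have "\<dots> = (\<Sum>s\<in>S. c s * ?A r s)"
        using fin by (intro sum.mono_neutral_left) (auto simp: T_def)
      finally show ?thesis using c(2)[OF that] by (simp only:)
    qed
    then have "zero_sum G T" using c(1) S by (auto simp: zero_sum_def T_def)
    moreover have "T \<subseteq> S" by (auto simp: T_def)
    ultimately show "\<exists>T. zero_sum G T \<and> T \<subseteq> S" by blast
  qed
  then show ?thesis by (simp add: adjacency_matroid_def)
qed

lemma ground_adjacency_matroid: "ground (M\<^sub>A G) = verts G"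
  by (simp add: adjacency_matroid_def)

lemma row_sum_split:
  assumes "finite S"
  shows "row_sum G r S = of_bool (v \<in> S) * adjacency_matrix G r v + row_sum G r (S - {v})"
  using assms by (cases "v \<in> S")
    (simp_all add: row_sum_def sum.remove[of S v] del: mult_bit_eq_and add_bit_eq_xor)

lemma row_sum_cong:
  "(\<And>s. s \<in> S \<Longrightarrow> adjacency_matrix G r s = adjacency_matrix H r s) \<Longrightarrow> row_sum G r S = row_sum H r S"
  unfolding row_sum_def by (rule sum.cong) auto

lemma finite_zero_sum: "finite_graph G \<Longrightarrow> zero_sum G S \<Longrightarrow> finite S"
  by (auto simp: zero_sum_def finite_graph_def intro: finite_subset)

section \<open>Isolating, deleting and locally complementing\<close>

lemma verts_simps [simp]:
  "verts (looped_isolated_at G v) = verts G"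
  "verts (looped_at G v) = verts G"
  "verts (local_complement G v) = verts G"
  "verts (delete_vertex G v) = verts G - {v}"
  by (simp_all add: looped_isolated_at_def looped_at_def unlooped_at_def local_complement_def
      delete_vertex_def)

lemma adjacency_matrix_looped_isolated_at:
  "adjacency_matrix (looped_isolated_at G v) x y =
    (if x = v \<or> y = v then of_bool (x = y) else adjacency_matrix G x y)"
  by (auto simp: adjacency_matrix_def looped_def adjacent_def looped_isolated_at_def looped_at_def
      unlooped_at_def)

lemma adjacency_matrix_delete_vertex:
  "x \<noteq> v \<Longrightarrow> y \<noteq> v \<Longrightarrow> adjacency_matrix (delete_vertex G v) x y = adjacency_matrix G x y"
  by (auto simp: adjacency_matrix_def looped_def adjacent_def delete_vertex_def)

text \<open>Row \<open>v\<close> of \<open>G(v,\<ell>i)\<close> is a unit vector, which keeps \<open>v\<close> out of every zero-sum set.\<close>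

lemma zero_sum_looped_isolated_at:
  assumes "finite_graph G" "v \<in> verts G"
  shows "zero_sum (looped_isolated_at G v) S \<longleftrightarrow> zero_sum (delete_vertex G v) S"
proof (cases "S \<subseteq> verts G")
  case True
  let ?L = "looped_isolated_at G v"
  have fin: "finite S" using True assms(1) by (auto simp: finite_graph_def intro: finite_subset)
  have "row_sum ?L v (S - {v}) = 0"
    unfolding row_sum_def by (intro sum.neutral) (auto simp: adjacency_matrix_looped_isolated_at)
  then have row_v: "row_sum ?L v S = 0 \<longleftrightarrow> v \<notin> S"
    using row_sum_split[OF fin, of ?L v v]
    by (simp add: adjacency_matrix_looped_isolated_at)
  have rest: "row_sum ?L r S = row_sum (delete_vertex G v) r S" if "v \<notin> S" "r \<noteq> v" for r
    using that by (intro row_sum_cong)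
      (auto simp: adjacency_matrix_looped_isolated_at adjacency_matrix_delete_vertex)
  show ?thesis
  proof (cases "v \<in> S")
    case True
    then show ?thesis using row_v assms(2) by (auto simp: zero_sum_def simp del: bit_not_zero_iff)
  next
    case False
    have "(\<forall>r\<in>verts G. row_sum ?L r S = 0) \<longleftrightarrow>
        (\<forall>r\<in>verts G - {v}. row_sum (delete_vertex G v) r S = 0)"
      using row_v rest[OF False] False by (metis Diff_iff singleton_iff)
    moreover have "S \<subseteq> verts G \<longleftrightarrow> S \<subseteq> verts G - {v}" using False by blast
    ultimately show ?thesis by (simp add: zero_sum_def)
  qed
next
  case False
  then show ?thesis by (auto simp: zero_sum_def)
qed

lemma adjacency_matroid_looped_isolated_at:
  assumes "finite_graph G" "v \<in> verts G"
  shows "M\<^sub>A (looped_isolated_at G v) = M\<^sub>A (delete_vertex G v) \<oplus> U\<^sub>1\<^sub>1 v"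
proof -
  have "zero_sum (looped_isolated_at G v) = zero_sum (delete_vertex G v)"
    using zero_sum_looped_isolated_at[OF assms] by blast
  then have "circuits (M\<^sub>A (looped_isolated_at G v)) = circuits (M\<^sub>A (delete_vertex G v))"
    using assms by (simp add: circuits_adjacency_matroid finite_graph_looped_isolated_at
        finite_graph_delete_vertex)
  moreover have "ground (M\<^sub>A (looped_isolated_at G v)) = insert v (ground (M\<^sub>A (delete_vertex G v)))"
    using assms(2) by (auto simp: ground_adjacency_matroid)
  ultimately show ?thesis by (simp add: direct_sum_def U\<^sub>1\<^sub>1_def)
qed

text \<open>The matrix of \<open>G\<^sup>v(v,\<ell>)\<close> in terms of that of \<open>G\<close>: a rank-one modification away from \<open>v\<close>, on
  the diagonal as well, because loops at neighbours of \<open>v\<close> are toggled like adjacencies.\<close>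

lemma adjacency_matrix_looped_local_complement:
  fixes G :: "'v graph" and v :: 'v
  assumes "finite_graph G"
  defines "H \<equiv> looped_at (local_complement G v) v"
  shows "adjacency_matrix H v v = 1"
    and "x \<noteq> v \<Longrightarrow> adjacency_matrix H v x = adjacency_matrix G v x"
    and "x \<noteq> v \<Longrightarrow> adjacency_matrix H x v = adjacency_matrix G v x"
    and "x \<noteq> v \<Longrightarrow> y \<noteq> v \<Longrightarrow> adjacency_matrix H x y =
      adjacency_matrix G x y + adjacency_matrix G v x * adjacency_matrix G v y"
proof -
  have comm: "adjacent K a b \<longleftrightarrow> adjacent K b a" for K :: "'v graph" and a b
  proof -
    have "Upair a b = Upair b a" by simp
    then show ?thesis unfolding adjacent_def by metis
  qed
  have loop: "looped H x \<longleftrightarrow> x = v \<or> looped G x \<noteq> adjacent G v x" for x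
    using looped_local_complement[OF assms(1), of v x]
    by (auto simp: H_def looped_def looped_at_def unlooped_at_def)
  have "adjacent H x y \<longleftrightarrow> adjacent (local_complement G v) x y" for x y
    by (auto simp: H_def adjacent_def looped_at_def unlooped_at_def)
  then have adj: "adjacent H x y \<longleftrightarrow> x \<noteq> y \<and> adjacent G x y \<noteq> (adjacent G v x \<and> adjacent G v y)"
    for x y
    using adjacent_local_complement[OF assms(1)] by blast
  have irrefl: "\<not> adjacent G v v" by (simp add: adjacent_def)
  show "adjacency_matrix H v v = 1" by (simp add: adjacency_matrix_def loop)
  show "adjacency_matrix H v x = adjacency_matrix G v x" if "x \<noteq> v"
    using that by (auto simp: adjacency_matrix_def adj irrefl)
  show "adjacency_matrix H x v = adjacency_matrix G v x" if "x \<noteq> v"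
    using that comm[of G x v] by (auto simp: adjacency_matrix_def adj irrefl)
  show "adjacency_matrix H x y =
      adjacency_matrix G x y + adjacency_matrix G v x * adjacency_matrix G v y"
    if "x \<noteq> v" "y \<noteq> v"
    using that by (auto simp: adjacency_matrix_def adj loop)
qed

text \<open>The pivot. For a neighbour \<open>x\<close> of \<open>v\<close>, the entries of row \<open>x\<close> changed by the local
  complementation, together with the entry \<open>1\<close> in column \<open>v\<close>, form a copy of row \<open>v\<close> of
  \<open>G\<^sup>v(v,\<ell>)\<close>; the row of a vertex not adjacent to \<open>v\<close>
  (and different from \<open>v\<close>) agrees with \<open>G - v\<close> and vanishes at \<open>v\<close>.\<close>

lemma row_sum_looped_local_complement:
  fixes G :: "'v graph" and v :: 'v
  assumes "finite_graph G" "finite S" "x \<noteq> v"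
  defines "H \<equiv> looped_at (local_complement G v) v"
  shows "row_sum H x S =
    row_sum (delete_vertex G v) x (S - {v}) + adjacency_matrix G v x * row_sum H v S"
proof -
  note entries = adjacency_matrix_looped_local_complement[OF assms(1), where v = v, folded H_def]
  let ?a = "adjacency_matrix G v x" and ?t = "of_bool (v \<in> S) :: bit"
  have row_v: "row_sum H v (S - {v}) = row_sum G v (S - {v})"
    using entries(2) by (intro row_sum_cong) blast
  have "row_sum H x (S - {v}) =
      (\<Sum>s\<in>S - {v}. adjacency_matrix (delete_vertex G v) x s + ?a * adjacency_matrix G v s)"
    unfolding row_sum_def using assms(3)
    by (intro sum.cong) (auto simp: entries adjacency_matrix_delete_vertex
        simp del: mult_bit_eq_and add_bit_eq_xor)
  also have "\<dots> = row_sum (delete_vertex G v) x (S - {v}) + ?a * row_sum H v (S - {v})"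
    by (simp add: row_v row_sum_def[of G] row_sum_def[of "delete_vertex G v"] sum.distrib
        sum_distrib_left del: mult_bit_eq_and add_bit_eq_xor)
  finally have "row_sum H x S =
      ?t * ?a + (row_sum (delete_vertex G v) x (S - {v}) + ?a * row_sum H v (S - {v}))"
    using row_sum_split[OF assms(2), of H x v] entries(3)[OF assms(3)] by (simp only:)
  moreover have "row_sum H v S = ?t + row_sum H v (S - {v})"
    using row_sum_split[OF assms(2), of H v v] entries(1) by (simp only: mult_1_right)
  ultimately show ?thesis by (simp only: algebra_simps)
qed

text \<open>Once row \<open>v\<close> sums to zero, the pivot leaves every other row sum equal to that in \<open>G - v\<close>.\<close>

lemma zero_sum_looped_local_complement:
  fixes G :: "'v graph" and v :: 'v
  assumes "finite_graph G" "v \<in> verts G"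
  defines "H \<equiv> looped_at (local_complement G v) v"
  shows "zero_sum H S \<longleftrightarrow>
    S \<subseteq> verts G \<and> row_sum H v S = 0 \<and> zero_sum (delete_vertex G v) (S - {v})"
proof (cases "S \<subseteq> verts G")
  case True
  have fin: "finite S" using True assms(1) by (auto simp: finite_graph_def intro: finite_subset)
  have H_verts: "verts H = verts G" by (simp add: H_def)
  \<comment> \<open>the diagonal entry \<open>1\<close> excludes the set \<open>{v}\<close>\<close>
  have "row_sum H v {v} = 1"
    using adjacency_matrix_looped_local_complement(1)[OF assms(1), where v = v]
    by (simp add: row_sum_def H_def)
  then have ne: "S \<noteq> {} \<longleftrightarrow> S - {v} \<noteq> {}" if "row_sum H v S = 0"
    using that by (cases "S = {v}") auto
  have rows: "row_sum H r S = row_sum (delete_vertex G v) r (S - {v})"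
    if "row_sum H v S = 0" "r \<noteq> v" for r
    using row_sum_looped_local_complement[OF assms(1) fin that(2), folded H_def] that(1)
    by simp
  show ?thesis
  proof (cases "row_sum H v S = 0")
    case row_v: True
    have "(\<forall>r\<in>verts G. row_sum H r S = 0) \<longleftrightarrow>
        (\<forall>r\<in>verts G - {v}. row_sum (delete_vertex G v) r (S - {v}) = 0)"
      using row_v rows by (metis Diff_iff singleton_iff)
    moreover have "S - {v} \<subseteq> verts G - {v}" using True by blast
    ultimately show ?thesis
      using True row_v ne[OF row_v] by (simp add: zero_sum_def H_verts)
  next
    case False
    then show ?thesis using assms(2) by (auto simp: zero_sum_def H_verts)
  qed
next
  case False
  then show ?thesis by (auto simp: zero_sum_def H_def)
qed

text \<open>Row \<open>v\<close> of \<open>G\<^sup>v(v,\<ell>)\<close> has entry \<open>1\<close> at \<open>v\<close>, so adjoining \<open>v\<close> when necessary extends a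
  zero-sum set of \<open>G - v\<close>.\<close>

lemma zero_sum_extend:
  assumes "finite_graph G" "v \<in> verts G" "zero_sum (delete_vertex G v) S"
  shows "\<exists>T \<subseteq> insert v S. zero_sum (looped_at (local_complement G v) v) T"
proof -
  let ?H = "looped_at (local_complement G v) v"
  have S: "S \<subseteq> verts G" "v \<notin> S" using assms(3) by (auto simp: zero_sum_def)
  have fin: "finite S"
    using assms(3) finite_graph_delete_vertex[OF assms(1)] by (rule finite_zero_sum[rotated])
  define T where "T = (if row_sum ?H v S = 0 then S else insert v S)"
  have "row_sum ?H v (insert v S) = 1 + row_sum ?H v S"
    using row_sum_split[of "insert v S" ?H v v] fin S(2)
      adjacency_matrix_looped_local_complement(1)[OF assms(1), where v = v] by simp
  then have "row_sum ?H v T = 0" by (simp add: T_def)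
  moreover have "T - {v} = S" "T \<subseteq> verts G" using S assms(2) by (auto simp: T_def)
  ultimately have "zero_sum ?H T"
    using zero_sum_looped_local_complement[OF assms(1,2)] assms(3) by simp
  moreover have "T \<subseteq> insert v S" by (auto simp: T_def)
  ultimately show ?thesis by blast
qed

text \<open>Contracting at the level of circuits or of zero-sum sets yields the same minimal sets: every
  zero-sum set contains a circuit, and removing \<open>v\<close> from a circuit gives a zero-sum set of
  \<open>G - v\<close>.\<close>

lemma contract_looped_local_complement:
  assumes "finite_graph G" "v \<in> verts G"
  shows "contract (M\<^sub>A (looped_at (local_complement G v) v)) v = M\<^sub>A (delete_vertex G v)"
proof -
  let ?H = "looped_at (local_complement G v) v"
  have fH: "finite_graph ?H"
    using assms by (intro finite_graph_looped_at finite_graph_local_complement) simp_all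
  note circ = circuits_adjacency_matroid[OF fH]
  let ?P = "\<lambda>S. S \<noteq> {} \<and> S \<subseteq> verts G - {v} \<and> (\<exists>C\<in>circuits (M\<^sub>A ?H). C \<subseteq> S \<union> {v})"
  have "minimal_sets ?P = minimal_sets (zero_sum (delete_vertex G v))"
  proof (rule minimal_sets_eqI)
    fix S assume S: "zero_sum (delete_vertex G v) S"
    obtain T where T: "T \<subseteq> insert v S" "zero_sum ?H T" using zero_sum_extend[OF assms S] by blast
    then obtain C where "C \<in> circuits (M\<^sub>A ?H)" "C \<subseteq> T"
      using minimal_sets_below[of T "zero_sum ?H"] finite_zero_sum[OF fH] unfolding circ by blast
    then have "\<exists>C\<in>circuits (M\<^sub>A ?H). C \<subseteq> S \<union> {v}" using T(1) by blast
    then show "?P S" using S by (simp add: zero_sum_def)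
  next
    fix S assume S: "?P S"
    then obtain C where C: "C \<in> circuits (M\<^sub>A ?H)" "C \<subseteq> S \<union> {v}" by blast
    then have "zero_sum ?H C" by (simp add: circ minimal_sets_def)
    then have "zero_sum (delete_vertex G v) (C - {v})"
      using zero_sum_looped_local_complement[OF assms] by blast
    then show "\<exists>T. zero_sum (delete_vertex G v) T \<and> T \<subseteq> S" using C(2) by blast
  qed
  then have "circuits (contract (M\<^sub>A ?H) v) = circuits (M\<^sub>A (delete_vertex G v))"
    using circuits_adjacency_matroid[OF finite_graph_delete_vertex[OF assms(1)]]
    by (simp add: contract_def ground_adjacency_matroid)
  then show ?thesis by (simp add: contract_def adjacency_matroid_def)
qed

theorem proposition22:
  fixes G :: "'v graph" and v :: 'v
  assumes "finite_graph G" and "v \<in> verts G"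
  shows "coloop (M\<^sub>A (looped_isolated_at G v)) v
    \<and> M\<^sub>A (looped_isolated_at G v) = M\<^sub>A (delete_vertex G v) \<oplus> U\<^sub>1\<^sub>1 v
    \<and> M\<^sub>A (delete_vertex G v) \<oplus> U\<^sub>1\<^sub>1 v
        = contract (M\<^sub>A (looped_at (local_complement G v) v)) v \<oplus> U\<^sub>1\<^sub>1 v
    \<and> nullity (M\<^sub>A (looped_isolated_at G v)) = nullity (M\<^sub>A (delete_vertex G v))
    \<and> nullity (M\<^sub>A (delete_vertex G v))
        = nullity (contract (M\<^sub>A (looped_at (local_complement G v) v)) v)
    \<and> nullity (contract (M\<^sub>A (looped_at (local_complement G v) v)) v)
        = nullity (M\<^sub>A (looped_at (local_complement G v) v))"
proof -
  let ?H = "looped_at (local_complement G v) v"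
  interpret D: finite_matroid "M\<^sub>A (delete_vertex G v)"
    using assms(1) by (intro finite_matroid_adjacency_matroid finite_graph_delete_vertex)
  interpret H: finite_matroid "M\<^sub>A ?H"
    using assms by (intro finite_matroid_adjacency_matroid finite_graph_looped_at
        finite_graph_local_complement) simp_all
  have v: "v \<notin> ground (M\<^sub>A (delete_vertex G v))" by (simp add: ground_adjacency_matroid)
  note isolated = adjacency_matroid_looped_isolated_at[OF assms]
  note contracted = contract_looped_local_complement[OF assms]
  have "coloop (M\<^sub>A (looped_isolated_at G v)) v"
    unfolding isolated using v D.circuit_subset
    by (auto simp: coloop_def direct_sum_def U\<^sub>1\<^sub>1_def)
  moreover have "nullity (M\<^sub>A (looped_isolated_at G v)) = nullity (M\<^sub>A (delete_vertex G v))"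
    unfolding isolated using v by (rule D.nullity_direct_sum_U\<^sub>1\<^sub>1)
  moreover have "nullity (contract (M\<^sub>A ?H) v) = nullity (M\<^sub>A ?H)"
    using assms(2) singleton_not_circuit_looped_at[of v "local_complement G v"]
    by (intro H.nullity_contract) (simp_all add: ground_adjacency_matroid)
  ultimately show ?thesis using isolated contracted by simp
qed

end
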